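(* Let $1<p<2$ and $D\in\mathbb{N}$. There is no constant $C_D$ such that the inequality $$\Big\|\sum_kf_k\Big\|_{L^p([0,1)^D)}\le C_D\,\Big\|\Big(\sum_k|f_k|^2\Big)^{1/2}\Big\|_{L^p([0,1)^D)}$$ holds for all partitions of $\mathbb{Z}_+^D$ into arbitrary pairwise disjoint sets $I_k\subseteq\mathbb{Z}_+^D$ with $\bigcup_kI_k=\mathbb{Z}_+^D$ and all families of functions $f_k$ on $[0,1)^D$ such that the Walsh–Fourier spectrum of $f_k$ is contained in $I_k$.
   Context: $\mathbb{Z}_+=\{0,1,2,\dots\}$. Walsh functions: for $x\in[0,1)$ with binary expansion $x=\sum_{k\ge1}x_k2^{-k}$, $x_k\in\{0,1\}$ (if there are two expansions, the one with $x_k\to0$), and $n=\sum_{k\ge1}n_k2^{k-1}\in\mathbb{Z}_+$, $n_k\in\{0,1\}$, set $w_n(x)=\prod_{k\ge1}(-1)^{x_kn_k}$. For $n\in\mathbb{Z}_+^D$, $w_n(x)=w_{n_1}(x_1)\cdots w_{n_D}(x_D)$; these form an orthonormal basis of $L^2[0,1)^D$. The Walsh–Fourier spectrum of $f$ is $\{n\in\mathbb{Z}_+^D:\langle f,w_n\rangle\ne0\}$, where $\langle f,w_n\rangle=\int_{[0,1)^D}f\,w_n$. *)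

theory Defs
  imports "HOL-Analysis.Analysis"
begin

text \<open>Binary digits, numbered from \<open>k = 1\<close>: \<open>x = (\<Sum>k\<ge>1. x\<^sub>k / 2 ^ k)\<close> for \<open>x\<close> in \<open>[0,1)\<close>
  and \<open>n = (\<Sum>k\<ge>1. n\<^sub>k * 2 ^ (k - 1))\<close>.  Taking the floor selects, for a dyadic
  rational \<open>x\<close>, the expansion whose digits are eventually \<open>0\<close>.\<close>

definition real_digit :: "real \<Rightarrow> nat \<Rightarrow> nat" where
  "real_digit x k = nat (\<lfloor>2 ^ k * x\<rfloor> mod 2)"

definition nat_digit :: "nat \<Rightarrow> nat \<Rightarrow> nat" where
  "nat_digit n k = n div 2 ^ (k - 1) mod 2"

text \<open>The product over all \<open>k \<ge> 1\<close> may be cut off at \<open>k = n\<close>, because \<open>n < 2 ^ n\<close> and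
  hence \<open>nat_digit n k = 0\<close> for \<open>k > n\<close>.\<close>

definition walsh1 :: "nat \<Rightarrow> real \<Rightarrow> real" where
  "walsh1 n x = (\<Prod>k=1..n. (-1) ^ (real_digit x k * nat_digit n k))"

definition walsh :: "nat ^ 'd \<Rightarrow> real ^ 'd \<Rightarrow> real" where
  "walsh n x = (\<Prod>i\<in>UNIV. walsh1 (n $ i) (x $ i))"

definition cube_measure :: "(real ^ 'd) measure" where
  "cube_measure = restrict_space lborel {x. \<forall>i. 0 \<le> x $ i \<and> x $ i < 1}"

definition walsh_coeff :: "(real ^ 'd \<Rightarrow> complex) \<Rightarrow> nat ^ 'd \<Rightarrow> complex" where
  "walsh_coeff f n = (LINT x|cube_measure. f x * of_real (walsh n x))"

definition walsh_spectrum :: "(real ^ 'd \<Rightarrow> complex) \<Rightarrow> (nat ^ 'd) set" where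
  "walsh_spectrum f = {n. walsh_coeff f n \<noteq> 0}"

text \<open>Powers with a positive real exponent on \<open>[0,\<infinity>]\<close>.\<close>

definition ennpowr :: "ennreal \<Rightarrow> real \<Rightarrow> ennreal" where
  "ennpowr a r = (if a = top then top else ennreal (enn2real a powr r))"

text \<open>The \<open>L\<^sup>p\<close> norm of a \<open>[0,\<infinity>]\<close>-valued function, possibly infinite; for a complex-valued
  \<open>f\<close> it is applied to the modulus of \<open>f\<close>.\<close>

definition Lp_norm_enn :: "real \<Rightarrow> (real ^ 'd \<Rightarrow> ennreal) \<Rightarrow> ennreal" where
  "Lp_norm_enn p h = ennpowr (\<integral>\<^sup>+ x. ennpowr (h x) p \<partial>cube_measure) (1 / p)"

definition Lp_norm :: "real \<Rightarrow> (real ^ 'd \<Rightarrow> complex) \<Rightarrow> ennreal" where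
  "Lp_norm p f = Lp_norm_enn p (\<lambda>x. ennreal (cmod (f x)))"

definition Lp_space :: "real \<Rightarrow> (real ^ 'd \<Rightarrow> complex) set" where
  "Lp_space p = {f \<in> borel_measurable cube_measure. Lp_norm p f < top}"

definition square_function :: "(nat \<Rightarrow> real ^ 'd \<Rightarrow> complex) \<Rightarrow> real ^ 'd \<Rightarrow> ennreal" where
  "square_function f x = ennpowr (\<Sum>k. ennreal ((cmod (f k x))\<^sup>2)) (1 / 2)"

text \<open>The function \<open>g\<close> is the sum of the series of the \<open>f k\<close> in \<open>L\<^sup>p\<close>.  A finite sum is the
  case in which all but finitely many \<open>f k\<close> vanish.\<close>

definition sums_in_Lp ::
  "real \<Rightarrow> (nat \<Rightarrow> real ^ 'd \<Rightarrow> complex) \<Rightarrow> (real ^ 'd \<Rightarrow> complex) \<Rightarrow> bool" where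
  "sums_in_Lp p f g \<longleftrightarrow> g \<in> Lp_space p \<and>
     (\<lambda>N. Lp_norm p (\<lambda>x. g x - (\<Sum>k<N. f k x))) \<longlonglongrightarrow> 0"

end

theory Submission
  imports Defs "HOL-Library.Nat_Bijection"
begin

text \<open>The inequality fails because some function \<open>g\<close> of modulus \<open>1\<close> splits into pieces with disjoint
  spectra whose square function is not constant, and tensor powers amplify the resulting gap.

  Let \<open>r\<close> and \<open>s\<close> be the Rademacher functions of two binary digits of one coordinate.  The bent function
  \<open>(r + s + r * s - 1) / 2\<close> takes the value \<open>1\<close> when both digits are \<open>0\<close> and \<open>- 1\<close> otherwise.  Split
  it into \<open>u = (r + s + r * s) / 2\<close> and the constant \<open>v = - 1 / 2\<close>.  The squared square
  function \<open>u\<^sup>2 + v\<^sup>2\<close> takes the value \<open>5 / 2\<close> on one quarter of the space and \<open>1 / 2\<close> on the rest.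
  Its mean is \<open>1\<close>, as Parseval's identity demands, but it is not constant, so for \<open>p < 2\<close> strict
  concavity of \<open>t powr (p / 2)\<close> makes the mean \<open>c\<close> of its \<open>p / 2\<close>-th power less than \<open>1\<close>
  (\<open>block_mean_less_1\<close>).

  Now take the product of \<open>n\<close> copies of this function in disjoint pairs of digits and expand it.
  The \<open>2 ^ n\<close> terms are indexed by the sets \<open>A\<close> of pairs on which the factor \<open>u\<close> was chosen, and a
  frequency in the spectrum of such a term determines \<open>A\<close>: these are the pairs in
  which the frequency has a nonzero digit (\<open>walsh_integral_block_product\<close>).  So the terms
  belong to disjoint sets of a partition of all frequencies.  Their sum has modulus \<open>1\<close> everywhere, while
  the square function is the product of the square functions of the pairs, with \<open>p\<close>-norm
  \<open>c powr (n / p)\<close> (\<open>square_function_norm\<close>).  This tends to \<open>0\<close> as \<open>n\<close> grows, in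
  every dimension, because only one coordinate is involved.

  All integrals are computed from one symmetry of the cube: flipping a single binary digit of
  one coordinate preserves the measure (\<open>integral_coord_flip\<close>) and multiplies a Walsh function by a sign
  (\<open>walsh_flip\<close>).  Averaging over the flips of one pair of digits gives both the
  orthogonality relations and the independence of different pairs (\<open>integral_block\<close>).\<close>

section \<open>Flipping one binary digit\<close>

definition digit_flip :: "nat \<Rightarrow> real \<Rightarrow> real" where
  "digit_flip k y = y + (if real_digit y k = 0 then 1 else - 1) / 2 ^ k"

text \<open>Written as a translation by one of two vectors, selected by the digit, so that its measure
  invariance follows from that of Lebesgue measure.\<close>

definition coord_flip :: "'d \<Rightarrow> nat \<Rightarrow> real ^ 'd \<Rightarrow> real ^ 'd" where
  "coord_flip i k x = x + axis i ((if real_digit (x $ i) k = 0 then 1 else - 1) / 2 ^ k)"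

lemma coord_flip_nth: "coord_flip i k x $ j = (if j = i then digit_flip k (x $ i) else x $ j)"
  by (simp add: coord_flip_def digit_flip_def axis_def)

lemma real_digit_cases: "real_digit y k = 0 \<or> real_digit y k = 1"
  by (auto simp: real_digit_def)

lemma real_digit_eq_0_iff: "real_digit y k = 0 \<longleftrightarrow> even \<lfloor>2 ^ k * y\<rfloor>"
  using pos_mod_bound[of 2 "\<lfloor>2 ^ k * y\<rfloor>"] by (auto simp: real_digit_def even_iff_mod_2_eq_zero)

lemma real_digit_cong: "(even \<lfloor>2 ^ k * y\<rfloor> \<longleftrightarrow> even \<lfloor>2 ^ l * z\<rfloor>) \<Longrightarrow> real_digit y k = real_digit z l"
  using real_digit_eq_0_iff[of y k] real_digit_eq_0_iff[of z l]
    real_digit_cases[of y k] real_digit_cases[of z l] by metis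

lemma floor_flip_self:
  "\<lfloor>2 ^ k * digit_flip k y\<rfloor> = \<lfloor>2 ^ k * y\<rfloor> + (if even \<lfloor>2 ^ k * y\<rfloor> then 1 else - 1)"
proof -
  have "2 ^ k * digit_flip k y = 2 ^ k * y + of_int (if even \<lfloor>2 ^ k * y\<rfloor> then 1 else - 1)"
    by (simp add: digit_flip_def real_digit_eq_0_iff distrib_left)
  then show ?thesis by (simp only: floor_add_int)
qed

text \<open>With \<open>N = \<lfloor>2 ^ k * y\<rfloor>\<close>, the flip exchanges the two integers \<open>N\<close> with the same half
  \<open>N div 2\<close>, and all digits before the \<open>k\<close>-th are read off from that half: no carry occurs.  The
  case \<open>j = 0\<close> says that the integer part survives, hence so does the unit interval.\<close>

lemma floor_flip_less:
  assumes "j < k"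
  shows "\<lfloor>2 ^ j * digit_flip k y\<rfloor> = \<lfloor>2 ^ j * y\<rfloor>"
proof -
  have lower: "\<lfloor>2 ^ j * z\<rfloor> = \<lfloor>2 ^ k * z\<rfloor> div 2 ^ (k - j)" for z :: real
  proof -
    have "2 ^ j * z = 2 ^ k * z / real_of_int (2 ^ (k - j))"
      using assms by (simp add: field_simps flip: power_add)
    then show ?thesis by (simp only: floor_divide_real_eq_div zero_le_numeral zero_le_power)
  qed
  have "(N + (if even N then 1 else - 1)) div 2 ^ (k - j) = N div 2 ^ (k - j)" for N :: int
  proof -
    have "(N + (if even N then 1 else - 1)) div 2 = N div 2" by presburger
    moreover have "M div 2 ^ (k - j) = M div 2 div 2 ^ (k - j - 1)" for M :: int
    proof -
      have "(2::int) ^ (k - j) = 2 * 2 ^ (k - j - 1)"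
        using assms by (simp flip: power_Suc)
      then show ?thesis by (simp only: zdiv_zmult2_eq zero_le_numeral zero_le_power)
    qed
    ultimately show ?thesis by metis
  qed
  then show ?thesis by (simp only: lower floor_flip_self)
qed

lemma floor_flip_greater:
  assumes "k < j"
  shows "even \<lfloor>2 ^ j * digit_flip k y\<rfloor> \<longleftrightarrow> even \<lfloor>2 ^ j * y\<rfloor>"
proof -
  define e :: int where "e = (if even \<lfloor>2 ^ k * y\<rfloor> then 1 else - 1)"
  have "2 ^ j * digit_flip k y = 2 ^ j * y + of_int (e * 2 ^ (j - k))"
    using assms by (simp add: digit_flip_def real_digit_eq_0_iff e_def distrib_left field_simps
      flip: power_add)
  then have "\<lfloor>2 ^ j * digit_flip k y\<rfloor> = \<lfloor>2 ^ j * y\<rfloor> + e * 2 ^ (j - k)"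
    by (simp only: floor_add_int)
  then show ?thesis using assms by simp
qed

lemma real_digit_flip_same: "real_digit (digit_flip k y) k = 1 - real_digit y k"
  using real_digit_eq_0_iff[of "digit_flip k y" k] real_digit_eq_0_iff[of y k]
    real_digit_cases[of y k] real_digit_cases[of "digit_flip k y" k]
  by (auto simp: floor_flip_self split: if_splits)

lemma real_digit_flip_other: "j \<noteq> k \<Longrightarrow> real_digit (digit_flip k y) j = real_digit y j"
  by (rule real_digit_cong) (cases "j < k"; simp add: floor_flip_less floor_flip_greater)

lemma digit_flip_unit_interval:
  assumes "0 < k"
  shows "0 \<le> digit_flip k y \<and> digit_flip k y < 1 \<longleftrightarrow> 0 \<le> y \<and> y < 1"
proof -
  have "\<lfloor>digit_flip k y\<rfloor> = \<lfloor>y\<rfloor>" using floor_flip_less[OF assms, of y] by simp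
  moreover have "0 \<le> z \<and> z < 1 \<longleftrightarrow> \<lfloor>z\<rfloor> = 0" for z :: real by (auto simp: floor_eq_iff)
  ultimately show ?thesis by simp
qed

abbreviation unit_cube :: "(real ^ 'd) set" where
  "unit_cube \<equiv> {x. \<forall>i. 0 \<le> x $ i \<and> x $ i < 1}"

lemma coord_flip_unit_cube: "0 < k \<Longrightarrow> coord_flip i k x \<in> unit_cube \<longleftrightarrow> x \<in> unit_cube"
  by (simp add: coord_flip_nth) (metis digit_flip_unit_interval)

section \<open>Flips preserve the measure of the cube\<close>

lemma measurable_vec_nth [measurable]: "(\<lambda>x. x $ i) \<in> borel_measurable (borel :: (real ^ 'd) measure)"
  by (intro borel_measurable_continuous_onI continuous_intros)

lemma measurable_real_digit [measurable]: "(\<lambda>y. real_digit y k) \<in> measurable borel (count_space UNIV)"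
  unfolding real_digit_def by measurable

lemma sets_unit_cube [measurable]: "unit_cube \<in> sets (borel :: (real ^ 'd) measure)"
  by measurable

lemma measurable_coord_flip [measurable]: 
  "coord_flip i k \<in> borel_measurable (borel :: (real ^ 'd) measure)"
proof -
  have "(\<lambda>x :: real ^ 'd.
      x + (if real_digit (x $ i) k = 0 then axis i (1 / 2 ^ k) else axis i (- 1 / 2 ^ k)))
    \<in> borel_measurable borel"
    by measurable
  moreover have "coord_flip i k =
      (\<lambda>x :: real ^ 'd.
        x + (if real_digit (x $ i) k = 0 then axis i (1 / 2 ^ k) else axis i (- 1 / 2 ^ k)))"
    by (auto simp: coord_flip_def)
  ultimately show ?thesis by simp
qed

text \<open>The flip exchanges the half-spaces \<open>digit = 0\<close> and \<open>digit = 1\<close>, and it is a translation on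
  each of them.\<close>

lemma distr_coord_flip:
  "distr lborel borel (coord_flip i k) = (lborel :: (real ^ 'd::finite) measure)"
proof (rule measure_eqI)
  fix A :: "(real ^ 'd) set" assume "A \<in> sets (distr lborel borel (coord_flip i k))"
  then have A [measurable]: "A \<in> sets borel" by simp
  define h :: "real ^ 'd" where "h = axis i (1 / 2 ^ k)"
  define D where "D = {x :: real ^ 'd. real_digit (x $ i) k = 0}"
  have D [measurable]: "D \<in> sets borel" unfolding D_def by measurable
  have shift: "emeasure lborel ((+) c -` B) = emeasure lborel B"
    if "B \<in> sets borel" for B and c :: "real ^ 'd"
    using that emeasure_distr[of "(+) c" lborel borel B] lborel_distr_plus[of c] by simp
  have [measurable]: "(+) c -` B \<in> sets borel" if "B \<in> sets borel" for B and c :: "real ^ 'd"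
    using measurable_sets_borel[of "(+) c" borel B] that by simp
  have digit_up: "h + x \<in> D \<longleftrightarrow> x \<notin> D" and digit_down: "x - h \<in> D \<longleftrightarrow> x \<notin> D" for x
  proof -
    have "(2::real) ^ k * (x $ i + 1 / 2 ^ k) = 2 ^ k * x $ i + of_int 1"
      "(2::real) ^ k * (x $ i - 1 / 2 ^ k) = 2 ^ k * x $ i - of_int 1"
      by (simp_all add: field_simps)
    then have "\<lfloor>2 ^ k * (x $ i + 1 / 2 ^ k)\<rfloor> = \<lfloor>2 ^ k * x $ i\<rfloor> + 1"
      "\<lfloor>2 ^ k * (x $ i - 1 / 2 ^ k)\<rfloor> = \<lfloor>2 ^ k * x $ i\<rfloor> - 1"
      by (simp_all only: floor_add_int floor_diff_of_int)
    then show "h + x \<in> D \<longleftrightarrow> x \<notin> D" "x - h \<in> D \<longleftrightarrow> x \<notin> D"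
      by (simp_all add: D_def h_def real_digit_eq_0_iff axis_def add.commute)
  qed
  have flip: "coord_flip i k x = (if x \<in> D then h + x else x - h)" for x
    by (auto simp: coord_flip_def D_def h_def axis_def vec_eq_iff)
  have up: "coord_flip i k -` A \<inter> D = (+) h -` (A - D)"
    and down: "coord_flip i k -` A - D = (+) (- h) -` (A \<inter> D)"
    by (auto simp: flip digit_up digit_down)
  have "emeasure (distr lborel borel (coord_flip i k)) A = emeasure lborel (coord_flip i k -` A)"
    by (simp add: emeasure_distr)
  also have "\<dots> = emeasure lborel ((coord_flip i k -` A \<inter> D) \<union> (coord_flip i k -` A - D))"
    by (rule arg_cong[where f = "emeasure lborel"]) auto
  also have "\<dots> = emeasure lborel ((+) h -` (A - D)) + emeasure lborel ((+) (- h) -` (A \<inter> D))"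
    unfolding up down
    by (rule plus_emeasure[symmetric])
       (auto simp: digit_up digit_down)
  also have "\<dots> = emeasure lborel (A - D) + emeasure lborel (A \<inter> D)"
    by (simp only: shift sets.Diff sets.Int A D)
  also have "\<dots> = emeasure lborel ((A - D) \<union> (A \<inter> D))"
    by (rule plus_emeasure) auto
  also have "(A - D) \<union> (A \<inter> D) = A" by auto
  finally show "emeasure (distr lborel borel (coord_flip i k)) A = emeasure lborel A" .
qed simp

lemma space_cube_measure: "space cube_measure = unit_cube"
  by (simp add: cube_measure_def space_restrict_space)

lemma measurable_cube_measure: "F \<in> borel_measurable borel \<Longrightarrow> F \<in> borel_measurable cube_measure"
  unfolding cube_measure_def by (intro measurable_restrict_space1) simp

text \<open>The half-open cube lies between the open and the closed unit box.\<close>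

lemma emeasure_cube: "emeasure cube_measure (space (cube_measure :: (real ^ 'd::finite) measure)) = 1"
proof -
  have One: "(\<Sum>b\<in>Basis. (b :: real ^ 'd) $ i) = 1" for i
    using inner_sum_Basis[of "axis i (1 :: real) :: real ^ 'd"]
    by (simp add: cart_eq_inner_axis inner_sum_left axis_in_Basis_iff)
  have "emeasure lborel (box 0 One :: (real ^ 'd) set) \<le> emeasure lborel (unit_cube :: (real ^ 'd) set)"
    by (rule emeasure_mono) (auto simp: mem_box_cart less_imp_le One)
  moreover have "emeasure lborel (unit_cube :: (real ^ 'd) set) \<le> emeasure lborel (cbox 0 One :: (real ^ 'd) set)"
    by (rule emeasure_mono) (auto simp: mem_box_cart less_imp_le One)
  ultimately show ?thesis
    by (simp add: space_cube_measure cube_measure_def emeasure_restrict_space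
        emeasure_lborel_box_eq emeasure_lborel_cbox_eq)
qed

lemma finite_measure_cube: "finite_measure (cube_measure :: (real ^ 'd::finite) measure)"
  by (rule finite_measureI) (simp add: emeasure_cube)

lemma measurable_cube_flip:
  assumes "0 < k"
  shows "coord_flip i k \<in> measurable (cube_measure :: (real ^ 'd::finite) measure) cube_measure"
  unfolding cube_measure_def using coord_flip_unit_cube[OF assms]
  by (intro measurable_restrict_space3) auto

lemma distr_cube_flip:
  assumes "0 < k"
  shows "distr cube_measure cube_measure (coord_flip i k) = (cube_measure :: (real ^ 'd::finite) measure)"
proof (rule measure_eqI)
  note meas = measurable_cube_flip[OF assms, of i]
  fix A :: "(real ^ 'd) set" assume "A \<in> sets (distr cube_measure cube_measure (coord_flip i k))"
  then have A: "A \<subseteq> unit_cube" "A \<in> sets borel" "A \<in> sets cube_measure"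
    by (auto simp: cube_measure_def sets_restrict_space_iff)
  have inside: "coord_flip i k -` A \<subseteq> unit_cube"
    using A(1) coord_flip_unit_cube[OF assms] by blast
  have "emeasure (distr cube_measure cube_measure (coord_flip i k)) A
    = emeasure cube_measure (coord_flip i k -` A)"
    using meas A(3) inside by (simp add: emeasure_distr space_cube_measure Int_absorb2)
  also have "\<dots> = emeasure (distr lborel borel (coord_flip i k)) A"
    using A inside by (simp add: cube_measure_def emeasure_restrict_space emeasure_distr)
  also have "\<dots> = emeasure cube_measure A"
    using A by (simp add: distr_coord_flip cube_measure_def emeasure_restrict_space)
  finally show "emeasure (distr cube_measure cube_measure (coord_flip i k)) A = emeasure cube_measure A" .
qed simp

lemma integral_coord_flip:
  fixes F :: "real ^ 'd::finite \<Rightarrow> 'b::{banach, second_countable_topology}"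
  assumes "0 < k" and "F \<in> borel_measurable borel"
  shows "(LINT x|cube_measure. F (coord_flip i k x)) = (LINT x|cube_measure. F x)"
  using integral_distr[OF measurable_cube_flip[OF assms(1)] measurable_cube_measure[OF assms(2)], of i]
    distr_cube_flip[OF assms(1), of i] by simp

section \<open>The two-digit blocks\<close>

text \<open>Block \<open>j\<close> consists of the digits \<open>2 * j + 1\<close> and \<open>2 * j + 2\<close>; the shift accounts for
  digits being numbered from \<open>1\<close>.\<close>

definition corner :: "nat \<Rightarrow> real \<Rightarrow> bool" where
  "corner j y \<longleftrightarrow> real_digit y (2 * j + 1) = 0 \<and> real_digit y (2 * j + 2) = 0"

lemma measurable_corner [measurable]: "Measurable.pred borel (corner j)"
  unfolding corner_def by measurable

lemma corner_flip_other:
  "k \<notin> {2 * j + 1, 2 * j + 2} \<Longrightarrow> corner j (digit_flip k y) \<longleftrightarrow> corner j y"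
  by (simp add: corner_def real_digit_flip_other)

text \<open>Flipping the two digits of a block in all ways runs through its four states, and exactly one
  of them is the corner.\<close>

lemma sum_over_block:
  fixes \<phi> :: "bool \<Rightarrow> real" and j :: nat
  defines "a \<equiv> digit_flip (2 * j + 1)" and "b \<equiv> digit_flip (2 * j + 2)"
  shows "\<phi> (corner j y) + \<phi> (corner j (a y)) + \<phi> (corner j (b y)) + \<phi> (corner j (b (a y)))
    = \<phi> True + 3 * \<phi> False"
  using real_digit_cases[of y "2 * j + 1"] real_digit_cases[of y "2 * j + 2"]
  by (auto simp: corner_def a_def b_def real_digit_flip_same real_digit_flip_other)

lemma integrable_cube_bounded:
  fixes F :: "real ^ 'd::finite \<Rightarrow> real"
  assumes "F \<in> borel_measurable borel" and "\<And>x. \<bar>F x\<bar> \<le> B"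
  shows "integrable cube_measure F"
  using assms measurable_cube_measure[OF assms(1)]
  by (intro finite_measure.integrable_const_bound[OF finite_measure_cube, of _ B]) auto

text \<open>Independence of a block from everything that its flips leave unchanged: since the flips
  preserve the integral, the integrand may be averaged over the four states of the block.\<close>

lemma integral_block:
  fixes G :: "real ^ 'd::finite \<Rightarrow> real" and \<phi> :: "bool \<Rightarrow> real"
  assumes G [measurable]: "G \<in> borel_measurable borel" and bound: "\<And>x. \<bar>G x\<bar> \<le> B"
    and inv: "\<And>k x. k \<in> {2 * j + 1, 2 * j + 2} \<Longrightarrow> G (coord_flip i k x) = G x"
  shows "(LINT x|cube_measure. \<phi> (corner j (x $ i)) * G x)
    = (\<phi> True + 3 * \<phi> False) / 4 * (LINT x|cube_measure. G x)"
proof -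
  define a b :: "real ^ 'd \<Rightarrow> real ^ 'd"
    where "a = coord_flip i (2 * j + 1)" and "b = coord_flip i (2 * j + 2)"
  have [measurable]: "a \<in> borel_measurable borel" "b \<in> borel_measurable borel"
    by (auto simp: a_def b_def)
  define F where "F x = \<phi> (corner j (x $ i)) * G x" for x
  have F [measurable]: "F \<in> borel_measurable borel" unfolding F_def by measurable
  have "\<bar>F x\<bar> \<le> max \<bar>\<phi> True\<bar> \<bar>\<phi> False\<bar> * B" for x
    unfolding F_def abs_mult using bound[of x]
    by (intro mult_mono) (cases "corner j (x $ i)"; auto)+
  then have int: "integrable cube_measure (\<lambda>x. F (T x))" if "T \<in> borel_measurable borel"
    for T :: "real ^ 'd \<Rightarrow> real ^ 'd"
    using that by (intro integrable_cube_bounded) auto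
  have four: "F x + F (a x) + F (b x) + F (b (a x)) = (\<phi> True + 3 * \<phi> False) * G x" for x
    using sum_over_block[of \<phi> j "x $ i"]
    by (simp add: F_def a_def b_def inv coord_flip_nth flip: distrib_right)
  have ia: "(LINT x|cube_measure. H (a x)) = (LINT x|cube_measure. H x)"
    and ib: "(LINT x|cube_measure. H (b x)) = (LINT x|cube_measure. H x)"
    if "H \<in> borel_measurable borel" for H :: "real ^ 'd \<Rightarrow> real"
    using that by (simp_all add: a_def b_def integral_coord_flip)
  have "4 * (LINT x|cube_measure. F x) = (LINT x|cube_measure. F x) + (LINT x|cube_measure. F (a x))
    + (LINT x|cube_measure. F (b x)) + (LINT x|cube_measure. F (b (a x)))"
    using ia[of F] ib[of F] ia[of "\<lambda>x. F (b x)"] by simp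
  also have "\<dots> = (LINT x|cube_measure. F x + F (a x) + F (b x) + F (b (a x)))"
    using int[of "\<lambda>x. x"] int[of a] int[of b] int[of "\<lambda>x. b (a x)"] by simp
  also have "\<dots> = (\<phi> True + 3 * \<phi> False) * (LINT x|cube_measure. G x)"
    by (simp add: four)
  finally show ?thesis by (simp add: F_def)
qed

lemma integral_block_product:
  fixes \<phi> :: "bool \<Rightarrow> real" and i :: "'d::finite"
  shows "(LINT x|(cube_measure :: (real ^ 'd) measure). (\<Prod>j<n. \<phi> (corner j (x $ i))))
    = ((\<phi> True + 3 * \<phi> False) / 4) ^ n"
proof (induction n)
  case 0
  show ?case by (simp add: measure_def emeasure_cube)
next
  case (Suc n)
  define B where "B = max \<bar>\<phi> True\<bar> \<bar>\<phi> False\<bar>"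
  have "\<bar>\<Prod>j<n. \<phi> (corner j (x $ i))\<bar> \<le> B ^ n" for x :: "real ^ 'd"
  proof -
    have "\<bar>\<phi> c\<bar> \<le> B" for c by (cases c) (auto simp: B_def)
    then have "(\<Prod>j<n. \<bar>\<phi> (corner j (x $ i))\<bar>) \<le> (\<Prod>j<n. B)" by (intro prod_mono) auto
    then show ?thesis by (simp add: abs_prod)
  qed
  then have "(LINT x|cube_measure. \<phi> (corner n (x $ i)) * (\<Prod>j<n. \<phi> (corner j (x $ i))))
    = (\<phi> True + 3 * \<phi> False) / 4
      * (LINT x|(cube_measure :: (real ^ 'd) measure). (\<Prod>j<n. \<phi> (corner j (x $ i))))"
    by (intro integral_block) (auto simp: coord_flip_nth corner_flip_other intro!: prod.cong)
  then show ?case by (simp add: Suc.IH mult.commute)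
qed

section \<open>Walsh functions under digit flips\<close>

text \<open>The \<open>k\<close>-th digit of \<open>y\<close> enters only through the \<open>k\<close>-th factor.  This factor is absent from
  the finite product if \<open>k > m\<close>, but then the \<open>k\<close>-th digit of \<open>m\<close> is \<open>0\<close>.\<close>

lemma walsh1_flip:
  assumes "0 < k"
  shows "walsh1 m (digit_flip k y) = (- 1) ^ nat_digit m k * walsh1 m y"
proof (cases "k \<le> m")
  case True
  have same: "(- 1 :: real) ^ (real_digit (digit_flip k y) k * nat_digit m k)
    = (- 1) ^ nat_digit m k * (- 1) ^ (real_digit y k * nat_digit m k)"
    using real_digit_cases[of y k] by (elim disjE) (simp_all add: real_digit_flip_same flip: power_add)
  have k: "k \<in> {1..m}" using True assms by auto
  have "(\<Prod>l\<in>{1..m} - {k}. (- 1 :: real) ^ (real_digit (digit_flip k y) l * nat_digit m l))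
    = (\<Prod>l\<in>{1..m} - {k}. (- 1) ^ (real_digit y l * nat_digit m l))"
    by (intro prod.cong) (auto simp: real_digit_flip_other)
  then show ?thesis
    unfolding walsh1_def prod.remove[OF finite_atLeastAtMost k] same by (simp only: mult.assoc)
next
  case False
  then have "m < 2 ^ (k - 1)" using less_exp[of "k - 1"] by linarith
  then have "nat_digit m k = 0" by (simp add: nat_digit_def)
  moreover have "walsh1 m (digit_flip k y) = walsh1 m y"
    unfolding walsh1_def using False by (intro prod.cong) (auto simp: real_digit_flip_other)
  ultimately show ?thesis by simp
qed

lemma walsh_flip:
  fixes x :: "real ^ 'd::finite"
  assumes "0 < k"
  shows "walsh m (coord_flip i k x) = (- 1) ^ nat_digit (m $ i) k * walsh m x"
proof -
  have "(\<Prod>l\<in>UNIV - {i}. walsh1 (m $ l) (coord_flip i k x $ l)) = (\<Prod>l\<in>UNIV - {i}. walsh1 (m $ l) (x $ l))"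
    by (intro prod.cong) (auto simp: coord_flip_nth)
  then show ?thesis
    by (simp add: walsh_def prod.remove[of UNIV i] coord_flip_nth walsh1_flip[OF assms])
qed

lemma measurable_walsh [measurable]: "walsh m \<in> borel_measurable (borel :: (real ^ 'd::finite) measure)"
proof -
  have "(\<lambda>x :: real ^ 'd. (-1 :: real) ^ (real_digit (x $ i) k * l)) \<in> borel_measurable borel" for i k l
    by measurable
  then show ?thesis unfolding walsh_def walsh1_def by measurable
qed

lemma abs_walsh: "\<bar>walsh m (x :: real ^ 'd::finite)\<bar> = 1"
  by (simp add: walsh_def walsh1_def abs_prod power_abs)

section \<open>Products over blocks and their spectra\<close>

text \<open>On one block, \<open>block_factor True\<close> is \<open>(r + s + r * s) / 2\<close>, where \<open>r\<close> and \<open>s\<close> are the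
  Rademacher functions of the two digits, and \<open>block_factor False\<close> is the constant \<open>- 1 / 2\<close>.
  Their sum takes only the values \<open>1\<close> and \<open>- 1\<close>.\<close>

definition block_factor :: "bool \<Rightarrow> bool \<Rightarrow> real" where
  "block_factor b c = (if b \<and> c then 3 / 2 else - 1 / 2)"

definition block_product :: "nat \<Rightarrow> nat set \<Rightarrow> real \<Rightarrow> real" where
  "block_product n A y = (\<Prod>j<n. block_factor (j \<in> A) (corner j y))"

text \<open>The blocks on which \<open>w\<^sub>m\<close> is not constant.  For \<open>A \<subseteq> {..<n}\<close> the spectrum of
  \<open>block_product n A\<close> consists of frequencies whose active blocks are exactly those in \<open>A\<close>.\<close>

definition active_blocks :: "nat \<Rightarrow> nat \<Rightarrow> nat set" where
  "active_blocks n m = {j. j < n \<and> (nat_digit m (2 * j + 1) \<noteq> 0 \<or> nat_digit m (2 * j + 2) \<noteq> 0)}"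

lemma abs_block_product_le: "\<bar>block_product n A y\<bar> \<le> (3 / 2) ^ n"
proof -
  have "(\<Prod>j<n. \<bar>block_factor (j \<in> A) (corner j y)\<bar>) \<le> (\<Prod>j<n. 3 / 2)"
    by (intro prod_mono) (auto simp: block_factor_def)
  then show ?thesis by (simp add: block_product_def abs_prod)
qed

lemma measurable_block_product [measurable]: "block_product n A \<in> borel_measurable borel"
  unfolding block_product_def by measurable

text \<open>A block \<open>j\<close> in which \<open>A\<close> and the active blocks differ makes the integral vanish.  If \<open>j\<close> is
  active but not in \<open>A\<close>, flipping a suitable digit changes the sign of \<open>w\<^sub>m\<close> and nothing else.
  If \<open>j\<close> is in \<open>A\<close> but not active, then \<open>w\<^sub>m\<close> ignores the block and \<open>block_factor True\<close>
  has mean \<open>0\<close> over it.\<close>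

lemma walsh_integral_block_product:
  fixes m :: "nat ^ 'd::finite"
  assumes A: "A \<subseteq> {..<n}" and ne: "active_blocks n (m $ i) \<noteq> A"
  shows "(LINT x|cube_measure. block_product n A (x $ i) * walsh m x) = 0"
proof -
  obtain j where j: "j < n" "j \<in> active_blocks n (m $ i) \<longleftrightarrow> j \<notin> A"
    using A ne unfolding active_blocks_def by blast
  define R where "R x = (\<Prod>l\<in>{..<n} - {j}. block_factor (l \<in> A) (corner l (x $ i))) * walsh m x"
    for x :: "real ^ 'd"
  have split: "block_product n A (x $ i) * walsh m x = block_factor (j \<in> A) (corner j (x $ i)) * R x"
    for x :: "real ^ 'd"
    using j(1) by (simp add: block_product_def R_def prod.remove[of _ j])
  have [measurable]: "R \<in> borel_measurable borel" unfolding R_def by measurable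
  have R_flip: "R (coord_flip i k x) = (- 1) ^ nat_digit (m $ i) k * R x"
    if "k \<in> {2 * j + 1, 2 * j + 2}" for k x
  proof -
    have "l \<noteq> j \<Longrightarrow> corner l (digit_flip k y) = corner l y" for l y
      using that by (intro corner_flip_other) auto
    moreover have "0 < k" using that by auto
    ultimately show ?thesis
      by (simp add: R_def coord_flip_nth walsh_flip)
  qed
  show ?thesis
  proof (cases "j \<in> A")
    case False
    then obtain k where k: "k \<in> {2 * j + 1, 2 * j + 2}" "nat_digit (m $ i) k \<noteq> 0"
      using j by (auto simp: active_blocks_def)
    then have "nat_digit (m $ i) k = 1" by (simp add: nat_digit_def)
    then have "R (coord_flip i k x) = - R x" for x using R_flip[OF k(1)] by simp
    then have "(LINT x|cube_measure. R x) = - (LINT x|cube_measure. R x)"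
      using integral_coord_flip[of k R i] k(1) by auto
    then show ?thesis using False by (simp add: split block_factor_def)
  next
    case True
    then have zero: "k \<in> {2 * j + 1, 2 * j + 2} \<Longrightarrow> nat_digit (m $ i) k = 0" for k
      using j by (auto simp: active_blocks_def)
    have "\<bar>R x\<bar> \<le> (3 / 2) ^ card ({..<n} - {j})" for x
    proof -
      have "(\<Prod>l\<in>{..<n} - {j}. \<bar>block_factor (l \<in> A) (corner l (x $ i))\<bar>) \<le> (\<Prod>l\<in>{..<n} - {j}. 3 / 2)"
        by (intro prod_mono) (auto simp: block_factor_def)
      then show ?thesis by (simp add: R_def abs_mult abs_prod abs_walsh)
    qed
    then have "(LINT x|cube_measure. block_factor True (corner j (x $ i)) * R x)
      = (block_factor True True + 3 * block_factor True False) / 4 * (LINT x|cube_measure. R x)"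
      using zero by (intro integral_block) (auto simp: R_flip)
    then show ?thesis using True by (simp add: split block_factor_def)
  qed
qed

text \<open>Expanding a product of \<open>n\<close> two-term sums.  Below, \<open>h\<close> is the identity (for the sum of the
  family) or the squared modulus (for its square function).\<close>

lemma sum_block_factor_products:
  fixes h :: "real \<Rightarrow> 'a::comm_semiring_1"
  assumes mult: "\<And>s t. h (s * t) = h s * h t" and "h 1 = 1"
  shows "(\<Sum>A\<in>Pow {..<n}. h (block_product n A y))
    = (\<Prod>j<n. h (block_factor True (corner j y)) + h (block_factor False (corner j y)))"
proof -
  have hprod: "h (prod g S) = (\<Prod>s\<in>S. h (g s))" for g and S :: "nat set"
    by (induction S rule: infinite_finite_induct) (auto simp: assms)
  have "h (block_product n A y) = (\<Prod>j\<in>A. h (block_factor True (corner j y)))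
     * (\<Prod>j\<in>{..<n} - A. h (block_factor False (corner j y)))" if "A \<subseteq> {..<n}" for A
  proof -
    have "h (block_product n A y) = (\<Prod>j\<in>{..<n} - A. h (block_factor (j \<in> A) (corner j y)))
      * (\<Prod>j\<in>A. h (block_factor (j \<in> A) (corner j y)))"
      unfolding block_product_def hprod by (rule prod.subset_diff[OF that]) simp
    then show ?thesis by (simp add: mult.commute)
  qed
  then show ?thesis by (simp add: prod_add)
qed

section \<open>Norms of the sum and of the square function\<close>

lemma Lp_norm_bounded_finite:
  fixes F :: "real ^ 'd::finite \<Rightarrow> complex"
  assumes "0 < p" and "\<And>x. cmod (F x) \<le> B"
  shows "Lp_norm p F < top"
proof -
  have "(\<integral>\<^sup>+ x. ennpowr (ennreal (cmod (F x))) p \<partial>cube_measure)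
    \<le> (\<integral>\<^sup>+ x. ennreal (B powr p) \<partial>(cube_measure :: (real ^ 'd) measure))"
    using assms by (intro nn_integral_mono) (auto simp: ennpowr_def intro!: ennreal_leI powr_mono2)
  also have "\<dots> < top" by (simp add: emeasure_cube)
  finally show ?thesis by (simp add: Lp_norm_def Lp_norm_enn_def ennpowr_def)
qed

text \<open>The products are enumerated by reading \<open>k\<close> as the code of a finite set; codes of sets
  that are not contained in \<open>{..<n}\<close> carry the zero function.\<close>

definition counter_family :: "'d \<Rightarrow> nat \<Rightarrow> nat \<Rightarrow> real ^ 'd \<Rightarrow> complex" where
  "counter_family i n k x =
    (if set_decode k \<subseteq> {..<n} then of_real (block_product n (set_decode k) (x $ i)) else 0)"

lemma counter_family_sum:
  assumes N: "set_encode ` Pow {..<n} \<subseteq> K" "finite K" and h0: "h 0 = (0 :: 'a :: comm_semiring_1)"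
    and hm: "\<And>s t :: real. h (of_real (s * t)) = h (of_real s) * h (of_real t)" and h1: "h 1 = 1"
  shows "(\<Sum>k\<in>K. h (counter_family i n k x))
    = (\<Prod>j<n. h (of_real (block_factor True (corner j (x $ i))))
             + h (of_real (block_factor False (corner j (x $ i)))))"
proof -
  have inj: "inj_on set_encode (Pow {..<n})"
    by (rule inj_on_subset[OF inj_on_set_encode]) (auto intro: finite_subset)
  have "(\<Sum>k\<in>K. h (counter_family i n k x)) = (\<Sum>k\<in>set_encode ` Pow {..<n}. h (counter_family i n k x))"
  proof (rule sum.mono_neutral_right[OF N(2,1)], safe)
    fix k assume "k \<notin> set_encode ` Pow {..<n}"
    then have "\<not> set_decode k \<subseteq> {..<n}" by (metis PowI image_eqI set_decode_inverse)
    then show "h (counter_family i n k x) = 0" by (simp add: counter_family_def h0)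
  qed
  also have "\<dots> = (\<Sum>A\<in>Pow {..<n}. h (of_real (block_product n A (x $ i))))"
    by (auto simp: sum.reindex[OF inj] counter_family_def finite_subset intro!: sum.cong)
  also have "\<dots> = (\<Prod>j<n. h (of_real (block_factor True (corner j (x $ i))))
             + h (of_real (block_factor False (corner j (x $ i)))))"
    using sum_block_factor_products[of "\<lambda>s. h (of_real s)" n "x $ i"] hm h1 by simp
  finally show ?thesis .
qed

text \<open>On each block the two squares add up to \<open>9 / 4 + 1 / 4\<close> in the corner and to
  \<open>1 / 4 + 1 / 4\<close> elsewhere.\<close>

lemma square_function_counter_family:
  fixes x :: "real ^ 'd::finite"
  shows "square_function (counter_family i n) x
    = ennreal ((\<Prod>j<n. if corner j (x $ i) then 5 / 2 else 1 / 2) powr (1 / 2))"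
proof -
  let ?f = "counter_family i n"
  have "(\<Sum>k. ennreal ((cmod (?f k x))\<^sup>2)) = (\<Sum>k\<in>set_encode ` Pow {..<n}. ennreal ((cmod (?f k x))\<^sup>2))"
  proof (rule suminf_finite)
    fix k assume "k \<notin> set_encode ` Pow {..<n}"
    then have "\<not> set_decode k \<subseteq> {..<n}" by (metis PowI image_eqI set_decode_inverse)
    then show "ennreal ((cmod (?f k x))\<^sup>2) = 0" by (simp add: counter_family_def)
  qed simp
  also have "\<dots> = ennreal (\<Sum>k\<in>set_encode ` Pow {..<n}. (cmod (?f k x))\<^sup>2)" by simp
  also have "(\<Sum>k\<in>set_encode ` Pow {..<n}. (cmod (?f k x))\<^sup>2)
    = (\<Prod>j<n. (cmod (of_real (block_factor True (corner j (x $ i)))))\<^sup>2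
           + (cmod (of_real (block_factor False (corner j (x $ i)))))\<^sup>2)"
    by (rule counter_family_sum) (auto simp: norm_mult power_mult_distrib)
  also have "\<dots> = (\<Prod>j<n. if corner j (x $ i) then 5 / 2 else 1 / 2)"
    by (intro prod.cong) (auto simp: block_factor_def power2_eq_square)
  finally show ?thesis
    by (simp add: square_function_def ennpowr_def prod_nonneg)
qed

lemma square_function_norm:
  fixes i :: "'d::finite"
  assumes "0 < p"
  shows "Lp_norm_enn p (square_function (counter_family i n))
    = ennreal (((((5 / 2) powr (p / 2) + 3 * (1 / 2) powr (p / 2)) / 4) powr (1 / p)) ^ n)"
proof -
  define \<phi> :: "bool \<Rightarrow> real" where "\<phi> c = (if c then 5 / 2 else 1 / 2) powr (p / 2)" for c
  define c where "c = (\<phi> True + 3 * \<phi> False) / 4"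
  have \<phi>_nonneg: "0 \<le> \<phi> b" for b by (simp add: \<phi>_def)
  have c: "c = ((5 / 2) powr (p / 2) + 3 * (1 / 2) powr (p / 2)) / 4"
    by (simp add: c_def \<phi>_def)
  have c0: "0 < c" by (simp add: c add_pos_pos)
  have prod_powr: "(\<Prod>j<n. g j) powr (p / 2) = (\<Prod>j<n. g j powr (p / 2))" if "\<And>j. 0 \<le> g j"
    for g :: "nat \<Rightarrow> real"
    using that by (induction n) (auto simp: powr_mult prod_nonneg)
  have pointwise: "ennpowr (square_function (counter_family i n) x) p = ennreal (\<Prod>j<n. \<phi> (corner j (x $ i)))"
    for x :: "real ^ 'd"
  proof -
    have "((\<Prod>j<n. if corner j (x $ i) then 5 / 2 else 1 / 2 :: real) powr (1 / 2)) powr p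
      = (\<Prod>j<n. \<phi> (corner j (x $ i)))"
      by (simp add: powr_powr prod_powr \<phi>_def)
    then show ?thesis by (simp add: square_function_counter_family ennpowr_def)
  qed
  have "integrable cube_measure (\<lambda>x :: real ^ 'd. \<Prod>j<n. \<phi> (corner j (x $ i)))"
  proof (rule integrable_cube_bounded)
    show "\<bar>\<Prod>j<n. \<phi> (corner j (x $ i))\<bar> \<le> (max (\<phi> True) (\<phi> False)) ^ n" for x :: "real ^ 'd"
    proof -
      have "\<bar>\<phi> b\<bar> \<le> max (\<phi> True) (\<phi> False)" for b by (cases b) (auto simp: \<phi>_def)
      then have "(\<Prod>j<n. \<bar>\<phi> (corner j (x $ i))\<bar>) \<le> (\<Prod>j<n. max (\<phi> True) (\<phi> False))"
        by (intro prod_mono) auto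
      then show ?thesis by (simp add: abs_prod)
    qed
  qed measurable
  then have "(\<integral>\<^sup>+ x. ennreal (\<Prod>j<n. \<phi> (corner j (x $ i))) \<partial>(cube_measure :: (real ^ 'd) measure))
    = ennreal (c ^ n)"
    by (subst nn_integral_eq_integral) (auto simp: integral_block_product c_def \<phi>_nonneg intro!: prod_nonneg)
  moreover have "(c ^ n) powr (1 / p) = (c powr (1 / p)) ^ n"
    using c0 by (simp add: powr_powr mult.commute flip: powr_realpow)
  ultimately show ?thesis
    unfolding Lp_norm_enn_def pointwise using c0 by (simp add: ennpowr_def flip: c)
qed

lemma Lp_norm_unimodular:
  fixes F :: "real ^ 'd::finite \<Rightarrow> complex"
  assumes "\<And>x. cmod (F x) = 1"
  shows "Lp_norm p F = 1"
  by (simp add: Lp_norm_def Lp_norm_enn_def ennpowr_def assms emeasure_cube)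

text \<open>The strict weighted inequality of arithmetic and geometric means for \<open>t\<close> and \<open>1\<close>, with
  arithmetic mean \<open>z\<close>.  It follows from \<open>ln u \<le> u - 1\<close> at \<open>u = t / z\<close> and \<open>u = 1 / z\<close>, where the
  right-hand sides average to \<open>0\<close>; strictness comes from \<open>z \<noteq> 1\<close>.\<close>

lemma powr_less_tangent:
  fixes t \<theta> :: real
  assumes "0 < t" "t \<noteq> 1" "0 < \<theta>" "\<theta> < 1"
  shows "t powr \<theta> < 1 + \<theta> * (t - 1)"
proof -
  define z where "z = 1 + \<theta> * (t - 1)"
  have "z = (1 - \<theta>) + \<theta> * t" by (simp add: z_def algebra_simps)
  then have z: "0 < z" using assms by (simp add: add_pos_pos)
  have z1: "z \<noteq> 1" using assms by (simp add: z_def)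
  have "ln (t / z) \<le> t / z - 1" using assms z by (intro ln_le_minus_one) simp
  then have 1: "\<theta> * ln (t / z) \<le> \<theta> * (t / z - 1)" using assms by simp
  have "ln (1 / z) \<noteq> 1 / z - 1" using ln_eq_minus_one[of "1 / z"] z z1 by auto
  moreover have "ln (1 / z) \<le> 1 / z - 1" using z by (intro ln_le_minus_one) simp
  ultimately have 2: "(1 - \<theta>) * ln (1 / z) < (1 - \<theta>) * (1 / z - 1)" using assms by simp
  have "\<theta> * (t / z - 1) + (1 - \<theta>) * (1 / z - 1) = (1 + \<theta> * (t - 1)) / z - 1"
    by (simp add: algebra_simps add_divide_distrib diff_divide_distrib)
  also have "\<dots> = 0" using z by (simp flip: z_def)
  finally have "\<theta> * ln (t / z) + (1 - \<theta>) * ln (1 / z) < 0" using 1 2 by linarith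
  then have "\<theta> * ln t < ln z" using assms z by (simp add: ln_div algebra_simps)
  then have "exp (\<theta> * ln t) < exp (ln z)" by simp
  then show ?thesis using assms z by (simp add: powr_def flip: z_def)
qed

text \<open>The four values \<open>5 / 2\<close>, \<open>1 / 2\<close>, \<open>1 / 2\<close>, \<open>1 / 2\<close> have mean \<open>1\<close>, so the first-order terms
  of the tangent bounds at \<open>1\<close> cancel.\<close>

lemma block_mean_less_1:
  assumes "0 < p" "p < (2::real)"
  shows "((5 / 2) powr (p / 2) + 3 * (1 / 2) powr (p / 2)) / 4 < (1::real)"
  using powr_less_tangent[of "5 / 2" "p / 2"] powr_less_tangent[of "1 / 2" "p / 2"] assms by simp

section \<open>Failure of the inequality\<close>

theorem mainTheorem5:
  fixes p :: real
  assumes "1 < p" and "p < 2"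
  shows "\<not> (\<exists>C::real.
    \<forall>(I :: nat \<Rightarrow> (nat ^ 'd::finite) set) (f :: nat \<Rightarrow> real ^ 'd \<Rightarrow> complex) (g :: real ^ 'd \<Rightarrow> complex).
      disjoint_family I \<longrightarrow>
      (\<Union>k. I k) = UNIV \<longrightarrow>
      (\<forall>k. f k \<in> Lp_space p \<and> walsh_spectrum (f k) \<subseteq> I k) \<longrightarrow>
      sums_in_Lp p f g \<longrightarrow>
      Lp_norm p g \<le> ennreal C * Lp_norm_enn p (square_function f))"
proof
  assume "\<exists>C::real.
    \<forall>(I :: nat \<Rightarrow> (nat ^ 'd::finite) set) (f :: nat \<Rightarrow> real ^ 'd \<Rightarrow> complex) (g :: real ^ 'd \<Rightarrow> complex).
      disjoint_family I \<longrightarrow>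
      (\<Union>k. I k) = UNIV \<longrightarrow>
      (\<forall>k. f k \<in> Lp_space p \<and> walsh_spectrum (f k) \<subseteq> I k) \<longrightarrow>
      sums_in_Lp p f g \<longrightarrow>
      Lp_norm p g \<le> ennreal C * Lp_norm_enn p (square_function f)"
  then obtain C :: real where C: "\<And>(I :: nat \<Rightarrow> (nat ^ 'd) set) f g.
      disjoint_family I \<Longrightarrow> (\<Union>k. I k) = UNIV \<Longrightarrow>
      (\<And>k. f k \<in> Lp_space p \<and> walsh_spectrum (f k) \<subseteq> I k) \<Longrightarrow> sums_in_Lp p f g \<Longrightarrow>
      Lp_norm p g \<le> ennreal C * Lp_norm_enn p (square_function f)"
    by blast
  define q where "q = (((5 / 2) powr (p / 2) + 3 * (1 / 2) powr (p / 2)) / 4) powr (1 / p)"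
  have q: "0 \<le> q" "q < 1"
    using powr_less_mono2[OF _ _ block_mean_less_1[of p], of "1 / p"] assms by (auto simp: q_def)
  fix i :: 'd
  \<comment> \<open>The bound \<open>C\<close> is not known to be nonnegative, and \<open>ennreal\<close> maps negative reals to \<open>0\<close>.\<close>
  have "1 \<le> max C 0 * q ^ n" for n
  proof -
    define I :: "nat \<Rightarrow> (nat ^ 'd) set" where "I k = {m. set_encode (active_blocks n (m $ i)) = k}" for k
    define f :: "nat \<Rightarrow> real ^ 'd \<Rightarrow> complex" where "f = counter_family i n"
    define g :: "real ^ 'd \<Rightarrow> complex"
      where "g x = (\<Prod>j<n. if corner j (x $ i) then 1 else - 1)" for x
    have g_norm: "cmod (g x) = 1" for x 
      unfolding g_def prod_norm[symmetric] by (rule prod.neutral) auto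
    have g_meas: "g \<in> borel_measurable borel" unfolding g_def by measurable
    have fin: "finite (active_blocks n m)" for m by (simp add: active_blocks_def)
    have f_meas: "f k \<in> borel_measurable borel" for k
      unfolding f_def counter_family_def by measurable
    have f_Lp: "f k \<in> Lp_space p" for k
    proof -
      have "cmod (f k x) \<le> (3 / 2) ^ n" for x
        using abs_block_product_le by (auto simp: f_def counter_family_def)
      then have "Lp_norm p (f k) < top"
        using assms by (intro Lp_norm_bounded_finite) auto
      then show ?thesis
        by (simp add: Lp_space_def measurable_cube_measure f_meas)
    qed
    have spectrum: "walsh_spectrum (f k) \<subseteq> I k" for k
    proof
      fix m assume m: "m \<in> walsh_spectrum (f k)"
      show "m \<in> I k"
      proof (rule ccontr)
        assume "m \<notin> I k"
        then have ne: "active_blocks n (m $ i) \<noteq> set_decode k" by (auto simp: I_def)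
        have "walsh_coeff (f k) m = 0"
        proof (cases "set_decode k \<subseteq> {..<n}")
          case True
          have "walsh_coeff (f k) m
            = (LINT x|cube_measure. of_real (block_product n (set_decode k) (x $ i) * walsh m x))"
            using True by (simp add: walsh_coeff_def f_def counter_family_def)
          also have "\<dots> = 0"
            unfolding integral_complex_of_real walsh_integral_block_product[OF True ne] by simp
          finally show ?thesis .
        qed (simp add: walsh_coeff_def f_def counter_family_def)
        then show False using m by (simp add: walsh_spectrum_def)
      qed
    qed
    have "sums_in_Lp p f g"
      unfolding sums_in_Lp_def
    proof
      show "g \<in> Lp_space p"
        using g_meas by (simp add: Lp_space_def measurable_cube_measure Lp_norm_unimodular g_norm)
      obtain N0 where N0: "set_encode ` Pow {..<n} \<subseteq> {..<N0}"
        using finite_nat_iff_bounded[of "set_encode ` Pow {..<n}"] by auto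
      have "Lp_norm p (\<lambda>x. g x - (\<Sum>k<N. f k x)) = 0" if "N0 \<le> N" for N
      proof -
        have N: "set_encode ` Pow {..<n} \<subseteq> {..<N}"
          by (rule order_trans[OF N0]) (use that in auto)
        have "(\<Sum>k<N. f k x) = g x" for x
        proof -
          have "(\<Sum>k<N. f k x) = (\<Prod>j<n. of_real (block_factor True (corner j (x $ i)))
                 + of_real (block_factor False (corner j (x $ i))))"
            unfolding f_def by (rule counter_family_sum[where h = "\<lambda>z. z", OF N]) auto
          also have "\<dots> = g x"
            unfolding g_def by (intro prod.cong) (auto simp: block_factor_def)
          finally show ?thesis .
        qed
        then show ?thesis using assms by (simp add: Lp_norm_def Lp_norm_enn_def ennpowr_def)
      qed
      then show "(\<lambda>N. Lp_norm p (\<lambda>x. g x - (\<Sum>k<N. f k x))) \<longlonglongrightarrow> 0"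
        by (intro tendsto_eventually eventually_sequentiallyI)
    qed
    then have "Lp_norm p g \<le> ennreal C * Lp_norm_enn p (square_function f)"
      using f_Lp spectrum by (intro C[of I]) (auto simp: I_def disjoint_family_on_def)
    then have "1 \<le> ennreal C * ennreal (q ^ n)"
      using assms by (simp add: Lp_norm_unimodular g_norm f_def square_function_norm q_def)
    also have "\<dots> \<le> ennreal (max C 0 * q ^ n)"
      using q by (simp add: ennreal_mult ennreal_leI mult_right_mono)
    finally show ?thesis by simp
  qed
  moreover have "(\<lambda>n. max C 0 * q ^ n) \<longlonglongrightarrow> max C 0 * 0"
    using q by (intro tendsto_mult tendsto_const LIMSEQ_realpow_zero)
  ultimately have "1 \<le> max C 0 * 0" by (intro LIMSEQ_le_const) auto
  then show False by simp
qed

end
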